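(* Let $p$ be a prime, let $G$ be a connected graph, let $V$ be a set of marked vertices of $G$, and suppose $c\in V$ is 2-valent in $G$. Suppose $P_1,\ldots,P_{p-1}$ are bipartitions of $V$ such that every part of every $P_j$ contains at least one vertex of $V\setminus\{c\}$. Then for any index $i$ there is a partition of \[ \mathcal{G}_{P_1,\ldots,P_i,\ldots,P_{p-1}} \cup \mathcal{G}_{P_1,\ldots,P_i^{c},\ldots,P_{p-1}} \] into subsets (orbits) each of whose sizes is divisible by $p$, where $P_i^c$ is the bipartition of $V$ obtained from $P_i$ by moving $c$ to the other part, and all $P_j$ with $j\neq i$ are unchanged. Consequently \[ g_{P_1,\ldots,P_i,\ldots,P_{p-1}} + g_{P_1,\ldots,P_i^{c},\ldots,P_{p-1}} \equiv 0 \pmod p. \]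
   Context: A spanning 2-forest is a spanning forest with exactly two trees; it is compatible with a bipartition $A\cup B$ of $V$ if one tree contains all of $A$ and none of $B$ and the other contains all of $B$ and none of $A$. Let $G^{(p-1)}$ be the multigraph with $p-1$ copies of each edge of $G$. For bipartitions $P_1,\ldots,P_{p-1}$ of $V$, $\mathcal{G}_{P_1,\ldots,P_{p-1}}$ is the set of ordered partitions $(\psi_1,\ldots,\psi_{p-1},\phi_1,\ldots,\phi_{p-1})$ of the edges of $G^{(p-1)}$ (copies of an edge not distinguished; i.e. ordered tuples of subgraphs of $G$ in which every edge of $G$ lies in exactly $p-1$ of the subgraphs) such that each $\psi_j$ is a spanning tree of $G$ and each $\phi_j$ is a spanning 2-forest of $G$ compatible with $P_j$; $g_{P_1,\ldots,P_{p-1}}$ is its cardinality. *)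

theory Defs
  imports
    "HOL-Library.Uprod"
    "HOL-Library.FuncSet"
    "HOL-Library.Disjoint_Sets"
    "HOL-Computational_Algebra.Primes"
    "HOL-Number_Theory.Cong"
begin

text \<open>
  Finite undirected graphs. Edges carry their own identity and are mapped to unordered pairs of
  end vertices, so parallel edges and self-loops are permitted. The forests and trees of the AFP
  entry Graph\_Theory exclude only directed cycles and are therefore not usable here.
\<close>

record ('v, 'e) mgraph =
  verts :: "'v set"
  edges :: "'e set"
  ends :: "'e \<Rightarrow> 'v uprod"

definition multigraph :: "('v, 'e) mgraph \<Rightarrow> bool" where
  "multigraph G \<longleftrightarrow> finite (verts G) \<and> finite (edges G) \<and>
     (\<forall>e\<in>edges G. set_uprod (ends G e) \<subseteq> verts G)"

text \<open>The second summand makes a self-loop contribute two to the valence.\<close>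

definition valence :: "('v, 'e) mgraph \<Rightarrow> 'v \<Rightarrow> nat" where
  "valence G v =
     card {e \<in> edges G. v \<in> set_uprod (ends G e)} + card {e \<in> edges G. ends G e = Upair v v}"

definition adjacency :: "('v, 'e) mgraph \<Rightarrow> ('v \<times> 'v) set" where
  "adjacency G = {(u, v). \<exists>e\<in>edges G. ends G e = Upair u v}"

definition same_component :: "('v, 'e) mgraph \<Rightarrow> ('v \<times> 'v) set" where
  "same_component G = (adjacency G)\<^sup>* \<inter> verts G \<times> verts G"

definition components :: "('v, 'e) mgraph \<Rightarrow> 'v set set" where
  "components G = verts G // same_component G"

definition connected_graph :: "('v, 'e) mgraph \<Rightarrow> bool" where
  "connected_graph G \<longleftrightarrow>
     verts G \<noteq> {} \<and> (\<forall>u\<in>verts G. \<forall>v\<in>verts G. (u, v) \<in> same_component G)"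

text \<open>
  A cycle passes through the pairwise distinct vertices \<open>vs\<close> along the pairwise distinct edges
  \<open>es\<close>; length one is a self-loop and length two a pair of parallel edges.
\<close>

definition is_cycle :: "('v, 'e) mgraph \<Rightarrow> 'v list \<Rightarrow> 'e list \<Rightarrow> bool" where
  "is_cycle G vs es \<longleftrightarrow>
     es \<noteq> [] \<and> length vs = length es \<and> distinct vs \<and> distinct es \<and> set es \<subseteq> edges G \<and>
     (\<forall>k<length es. ends G (es ! k) = Upair (vs ! k) (vs ! (Suc k mod length vs)))"

definition forest_graph :: "('v, 'e) mgraph \<Rightarrow> bool" where
  "forest_graph G \<longleftrightarrow> (\<nexists>vs es. is_cycle G vs es)"

definition tree_graph :: "('v, 'e) mgraph \<Rightarrow> bool" where
  "tree_graph G \<longleftrightarrow> connected_graph G \<and> forest_graph G"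

text \<open>
  A spanning subgraph of \<open>G\<close> is represented by its set \<open>F\<close> of edges. The trees of a spanning forest
  are its connected components, represented by their vertex sets; a tree may be a single vertex.
\<close>

definition spanning_subgraph :: "('v, 'e) mgraph \<Rightarrow> 'e set \<Rightarrow> ('v, 'e) mgraph" where
  "spanning_subgraph G F = G\<lparr>edges := F\<rparr>"

definition spanning_tree :: "('v, 'e) mgraph \<Rightarrow> 'e set \<Rightarrow> bool" where
  "spanning_tree G F \<longleftrightarrow> F \<subseteq> edges G \<and> tree_graph (spanning_subgraph G F)"

definition spanning_2forest :: "('v, 'e) mgraph \<Rightarrow> 'e set \<Rightarrow> bool" where
  "spanning_2forest G F \<longleftrightarrow>
     F \<subseteq> edges G \<and> forest_graph (spanning_subgraph G F) \<and>
     card (components (spanning_subgraph G F)) = 2"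

text \<open>Bipartitions are unordered.\<close>

definition bipartition :: "'v set \<Rightarrow> 'v set set \<Rightarrow> bool" where
  "bipartition V P \<longleftrightarrow> partition_on V P \<and> card P = 2"

definition move :: "'v \<Rightarrow> 'v set set \<Rightarrow> 'v set set" where
  "move c P = (\<lambda>A. if c \<in> A then A - {c} else insert c A) ` P"

definition compatible :: "('v, 'e) mgraph \<Rightarrow> 'e set \<Rightarrow> 'v set set \<Rightarrow> bool" where
  "compatible G F P \<longleftrightarrow>
     (\<exists>A B S T. P = {A, B} \<and> components (spanning_subgraph G F) = {S, T} \<and> S \<noteq> T \<and>
        A \<subseteq> S \<and> B \<inter> S = {} \<and> B \<subseteq> T \<and> A \<inter> T = {})"

text \<open>
  Tuples indexed by \<open>1, \<dots>, p - 1\<close> are extensional functions on \<open>{1..p - 1}\<close>, so that tuples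
  agreeing on all indices are equal.
\<close>

definition edge_partitions ::
  "('v, 'e) mgraph \<Rightarrow> nat \<Rightarrow> (nat \<Rightarrow> 'v set set) \<Rightarrow> ((nat \<Rightarrow> 'e set) \<times> (nat \<Rightarrow> 'e set)) set" where
  "edge_partitions G p P =
     {(\<psi>, \<phi>).
        \<psi> \<in> (\<Pi>\<^sub>E j\<in>{1..p - 1}. {F. spanning_tree G F}) \<and>
        \<phi> \<in> (\<Pi>\<^sub>E j\<in>{1..p - 1}. {F. spanning_2forest G F \<and> compatible G F (P j)}) \<and>
        (\<forall>e\<in>edges G. card {j \<in> {1..p - 1}. e \<in> \<psi> j} + card {j \<in> {1..p - 1}. e \<in> \<phi> j} = p - 1)}"

definition num_edge_partitions :: "('v, 'e) mgraph \<Rightarrow> nat \<Rightarrow> (nat \<Rightarrow> 'v set set) \<Rightarrow> nat" where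
  "num_edge_partitions G p P = card (edge_partitions G p P)"

end

theory Submission
  imports Defs
begin

text \<open>
  Let \<open>e\<close> and \<open>f\<close> be the two edges at \<open>c\<close>. None of the \<open>2(p - 1)\<close> subgraphs isolates \<open>c\<close>, and
  \<open>e\<close> and \<open>f\<close> are used \<open>2(p - 1)\<close> times in total, so each subgraph contains exactly one of them and
  has \<open>c\<close> as a leaf. Group the tuples by what remains after deleting \<open>e\<close> and \<open>f\<close>. Within a group,
  let \<open>K\<close> be the set of positions at which both \<open>e\<close> and \<open>f\<close> are admissible. It contains all \<open>p - 1\<close>
  trees and, because \<open>P\<^sub>i\<close> and its modification are both allowed, the \<open>i\<close>-th forest, so
  \<open>|K| \<ge> p\<close>. If \<open>m\<close> and \<open>n\<close> positions of \<open>K\<close> carry \<open>e\<close> and \<open>f\<close>, then \<open>m, n < p \<le> m + n\<close> and the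
  group has \<open>m + n choose m\<close> elements, a multiple of \<open>p\<close>.
\<close>

section \<open>Divisibility by a prime from interchanging two elements in a family of sets\<close>

text \<open>The prime divides the factorial of \<open>m + n\<close> but neither that of
  \<open>m\<close> nor that of \<open>n\<close>, so it survives in the quotient.\<close>

lemma prime_dvd_choose_add:
  fixes p m n :: nat
  assumes "prime p" "m < p" "n < p" "p \<le> m + n"
  shows "p dvd (m + n choose m)"
proof -
  have "fact m * fact n * (m + n choose m) = (fact (m + n) :: nat)"
    using binomial_fact_lemma[of m "m + n"] by simp
  moreover have "p dvd fact (m + n)" "\<not> p dvd fact m" "\<not> p dvd fact n"
    using assms by (simp_all add: prime_dvd_fact_iff)
  ultimately show ?thesis
    using assms(1) by (metis prime_dvd_mult_iff)
qed

text \<open>The counting argument freed from graphs: \<open>J\<close> indexes the positions,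
  \<open>A x\<close> collects the sets admissible at \<open>x\<close>, and \<open>J0\<close> is a
  stock of \<open>p\<close> positions where \<open>e\<close> and \<open>f\<close> can be
  interchanged whatever the rest of the set is. Further positions may be interchangeable for a
  particular rest \<open>F x - {e, f}\<close>; they only enlarge \<open>K\<close>, for whose size a
  lower bound \<open>p\<close> suffices.\<close>

lemma prime_dvd_card_swap_fibre:
  fixes A :: "'j \<Rightarrow> 'e set set" and J J0 :: "'j set" and E :: "'e set"
  assumes p: "prime p" and J: "finite J" "card J = 2 * (p - 1)"
    and ef: "e \<noteq> f" "e \<in> E" "f \<in> E"
    and J0: "J0 \<subseteq> J" "card J0 = p"
    and meets: "\<And>x Y. x \<in> J \<Longrightarrow> Y \<in> A x \<Longrightarrow> e \<in> Y \<or> f \<in> Y"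
    and swap: "\<And>x H. x \<in> J0 \<Longrightarrow> e \<notin> H \<Longrightarrow> f \<notin> H \<Longrightarrow> insert e H \<in> A x \<longleftrightarrow> insert f H \<in> A x"
    and U: "U = {F \<in> Pi\<^sub>E J A. \<forall>d\<in>E. card {x \<in> J. d \<in> F x} = p - 1}"
    and F: "F \<in> U"
  shows "p dvd card {F' \<in> U. \<forall>x\<in>J. F' x - {e, f} = F x - {e, f}}"
proof -
  \<comment> \<open>The edges e and f together occur as often as there are indices, and at least once per index.\<close>
  have one: "e \<in> F' x \<longleftrightarrow> f \<notin> F' x" if F': "F' \<in> U" and x: "x \<in> J" for F' x
  proof -
    let ?E = "{x \<in> J. e \<in> F' x}" and ?F = "{x \<in> J. f \<in> F' x}"
    have un: "?E \<union> ?F = J"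
      using F' meets by (fastforce simp: U PiE_iff)
    have "card ?E = p - 1" "card ?F = p - 1"
      using F' ef by (auto simp: U)
    moreover have "card ?E + card ?F = card (?E \<union> ?F) + card (?E \<inter> ?F)"
      using J by (intro card_Un_Int) auto
    ultimately have "card (?E \<inter> ?F) = 0"
      using un J by simp
    then have "?E \<inter> ?F = {}"
      using J by simp
    then show ?thesis using un x by blast
  qed
  define H where "H x = F x - {e, f}" for x
  have H: "e \<notin> H x" "f \<notin> H x" for x by (auto simp: H_def)
  \<comment> \<open>\<open>K\<close> depends on \<open>F\<close> only through \<open>H\<close>, so
    all members of the fibre share it.\<close>
  define K where "K = {x \<in> J. insert e (H x) \<in> A x \<and> insert f (H x) \<in> A x}"
  define m where "m = card {x \<in> K. e \<in> F x}"
  \<comment> \<open>The inverse of the bijection below: it rebuilds a family from the set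
    \<open>S\<close> of positions in \<open>K\<close> that receive \<open>e\<close>. Falling back on
    \<open>F\<close> elsewhere keeps the forced positions and also the default value outside
    \<open>J\<close>.\<close>
  define g where "g S x = (if x \<in> K then insert (if x \<in> S then e else f) (H x) else F x)" for S x
  let ?Fib = "{F' \<in> U. \<forall>x\<in>J. F' x - {e, f} = F x - {e, f}}"
  have KJ: "K \<subseteq> J" and finK: "finite K"
    using J by (auto simp: K_def)
  have shape: "F' x = insert (if e \<in> F' x then e else f) (H x)" if "F' \<in> ?Fib" "x \<in> J" for F' x
  proof -
    have "F' x - {e, f} = H x" using that by (simp add: H_def)
    moreover have "e \<in> F' x \<longleftrightarrow> f \<notin> F' x" using one that by blast
    ultimately show ?thesis by auto
  qed
  have FF: "F \<in> ?Fib" using F by simp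
  have inA: "F' x \<in> A x" if "F' \<in> ?Fib" "x \<in> J" for F' x
    using that by (auto simp: U)
  \<comment> \<open>Outside \<open>K\<close> at most one of the two completions of
    \<open>H x\<close> is admissible, which leaves no choice.\<close>
  have offK: "F' x = F x" if "F' \<in> ?Fib" "x \<in> J - K" for F' x
  proof -
    have "F' x = insert e (H x) \<or> F' x = insert f (H x)"
      "F x = insert e (H x) \<or> F x = insert f (H x)"
      using shape[OF that(1), of x] shape[OF FF, of x] that(2) by (auto split: if_splits)
    with inA[OF that(1), of x] inA[OF FF, of x] that(2) show ?thesis
      by (auto simp: K_def)
  qed
  have count: "card {x \<in> J. e \<in> F' x} = card {x \<in> K. e \<in> F' x} + card {x \<in> J - K. e \<in> F' x}" for F'
    using J KJ by (subst card_Un_disjoint[symmetric]) (auto intro!: arg_cong[where f = card] simp: finite_subset)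
  have cardF: "m + card {x \<in> J - K. e \<in> F x} = p - 1"
    using count[of F] F ef by (auto simp: m_def U)
  \<comment> \<open>The set \<open>F x\<close> shows that one completion is admissible, and
    \<open>swap\<close> supplies the other.\<close>
  have "J0 \<subseteq> K"
  proof
    fix x assume x: "x \<in> J0"
    then have "insert e (H x) \<in> A x \<or> insert f (H x) \<in> A x"
      using shape[OF FF, of x] inA[OF FF, of x] J0 by (auto split: if_splits)
    then show "x \<in> K"
      using x swap[OF x H] J0 by (auto simp: K_def)
  qed
  then have pK: "p \<le> card K"
    using J0 finK card_mono by blast
  have "bij_betw (\<lambda>F'. {x \<in> K. e \<in> F' x}) ?Fib {S. S \<subseteq> K \<and> card S = m}"
  proof (rule bij_betw_byWitness[where f' = g])
    show "\<forall>F'\<in>?Fib. g {x \<in> K. e \<in> F' x} = F'"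
    proof (intro ballI ext)
      fix F' x assume F': "F' \<in> ?Fib"
      consider "x \<in> K" | "x \<in> J - K" | "x \<notin> J" by blast
      then show "g {x \<in> K. e \<in> F' x} x = F' x"
      proof cases
        case 1
        then show ?thesis using shape[OF F', of x] KJ by (auto simp: g_def)
      next
        case 2
        then show ?thesis using offK[OF F' 2] by (simp add: g_def)
      next
        case 3
        then have "F' x = undefined" "F x = undefined"
          using F' F by (auto simp: U PiE_def extensional_def)
        then show ?thesis using 3 KJ by (auto simp: g_def)
      qed
    qed
    show "\<forall>S\<in>{S. S \<subseteq> K \<and> card S = m}. {x \<in> K. e \<in> g S x} = S"
      using H ef by (auto simp: g_def)
    show "(\<lambda>F'. {x \<in> K. e \<in> F' x}) ` ?Fib \<subseteq> {S. S \<subseteq> K \<and> card S = m}"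
    proof (intro image_subsetI CollectI conjI)
      fix F' assume F': "F' \<in> ?Fib"
      \<comment> \<open>The occurrences of \<open>e\<close> outside \<open>K\<close> are fixed, so
        its prescribed total fixes the number inside \<open>K\<close>.\<close>
      have "{x \<in> J - K. e \<in> F' x} = {x \<in> J - K. e \<in> F x}"
        using offK[OF F'] by auto
      moreover have "card {x \<in> J. e \<in> F' x} = p - 1"
        using F' ef by (auto simp: U)
      ultimately show "card {x \<in> K. e \<in> F' x} = m"
        using count[of F'] cardF by simp
    qed auto
    show "g ` {S. S \<subseteq> K \<and> card S = m} \<subseteq> ?Fib"
    proof (intro image_subsetI CollectI conjI)
      fix S assume "S \<in> {S. S \<subseteq> K \<and> card S = m}"
      then have S: "S \<subseteq> K" "card S = m" by auto
      have e_card: "card {x \<in> J. e \<in> g S x} = p - 1"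
      proof -
        have "{x \<in> K. e \<in> g S x} = S" "{x \<in> J - K. e \<in> g S x} = {x \<in> J - K. e \<in> F x}"
          using H ef S by (auto simp: g_def)
        then show ?thesis using count[of "g S"] cardF S by simp
      qed
      \<comment> \<open>The positions carrying \<open>f\<close> are the complement of those carrying
        \<open>e\<close>, and \<open>2 * (p - 1) - (p - 1) = p - 1\<close>.\<close>
      have f_card: "card {x \<in> J. f \<in> g S x} = p - 1"
      proof -
        have "{x \<in> J. f \<in> g S x} = J - {x \<in> J. e \<in> g S x}"
          using H ef one[OF F] by (auto simp: g_def)
        then show ?thesis using e_card J by (simp add: card_Diff_subset)
      qed
      have "card {x \<in> J. d \<in> g S x} = p - 1" if d: "d \<in> E" for d
      proof -
        consider "d = e" | "d = f" | "d \<noteq> e" "d \<noteq> f" by blast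
        then show ?thesis
        proof cases
          case 3
          then have "{x \<in> J. d \<in> g S x} = {x \<in> J. d \<in> F x}"
            by (auto simp: g_def H_def)
          then show ?thesis using F d by (simp add: U)
        qed (use e_card f_card in auto)
      qed
      moreover have "g S \<in> Pi\<^sub>E J A"
        using F KJ by (auto simp: PiE_iff extensional_def g_def K_def U)
      ultimately show "g S \<in> U" by (simp add: U)
      show "\<forall>x\<in>J. g S x - {e, f} = F x - {e, f}"
        by (auto simp: g_def H_def)
    qed
  qed
  then have "card ?Fib = card {S. S \<subseteq> K \<and> card S = m}"
    by (rule bij_betw_same_card)
  then have fib: "card ?Fib = card K choose m"
    using n_subsets[OF finK, of m] by simp
  define n where "n = card {x \<in> K. e \<notin> F x}"
  have mn: "card K = m + n"
    unfolding m_def n_def using finK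
    by (subst card_Un_disjoint[symmetric]) (auto intro!: arg_cong[where f = card])
  \<comment> \<open>Positions of \<open>K\<close> without \<open>e\<close> carry \<open>f\<close>,
    which occurs only \<open>p - 1\<close> times.\<close>
  have "n \<le> card {x \<in> J. f \<in> F x}"
    unfolding n_def using J KJ one[OF F] by (intro card_mono) auto
  then have "n \<le> p - 1" using F ef by (simp add: U)
  moreover have "m \<le> p - 1" using cardF by simp
  ultimately show ?thesis
    using prime_dvd_choose_add[OF p, of m n] pK mn fib prime_gt_0_nat[OF p] by auto
qed

section \<open>Reachability in spanning subgraphs and the effect of a pendant edge\<close>

text \<open>Dropping the restriction to \<open>verts G\<close> found in
  \<open>same_component\<close> makes the relation reflexive everywhere and avoids membership side
  conditions.\<close>

definition reach :: "('v, 'e) mgraph \<Rightarrow> 'e set \<Rightarrow> ('v \<times> 'v) set" where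
  "reach G F = (adjacency (spanning_subgraph G F))\<^sup>*"

lemma adjacency_spanning_subgraph:
  "(u, v) \<in> adjacency (spanning_subgraph G F) \<longleftrightarrow> (\<exists>d\<in>F. ends G d = Upair u v)"
  by (simp add: adjacency_def spanning_subgraph_def)

lemma sym_adjacency: "sym (adjacency G)"
  by (auto simp: adjacency_def sym_def) (metis Upair_inject)

lemma reach_refl: "(u, u) \<in> reach G F"
  by (simp add: reach_def)

lemma reach_sym: "(u, v) \<in> reach G F \<Longrightarrow> (v, u) \<in> reach G F"
  by (metis reach_def sym_adjacency sym_rtrancl symD)

lemma reach_trans: "(u, v) \<in> reach G F \<Longrightarrow> (v, w) \<in> reach G F \<Longrightarrow> (u, w) \<in> reach G F"
  unfolding reach_def by (rule rtrancl_trans)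

lemma reach_edge: "d \<in> F \<Longrightarrow> ends G d = Upair u v \<Longrightarrow> (u, v) \<in> reach G F"
  unfolding reach_def by (rule r_into_rtrancl) (auto simp: adjacency_spanning_subgraph)

lemma reach_mono: "F \<subseteq> F' \<Longrightarrow> reach G F \<subseteq> reach G F'"
  unfolding reach_def by (rule rtrancl_mono) (auto 4 4 simp: adjacency_spanning_subgraph)

lemma verts_spanning_subgraph [simp]: "verts (spanning_subgraph G F) = verts G"
  by (simp add: spanning_subgraph_def)

lemma same_component_spanning_subgraph:
  "same_component (spanning_subgraph G F) = reach G F \<inter> verts G \<times> verts G"
  by (simp add: same_component_def reach_def)

lemma equiv_same_component: "equiv (verts G) (same_component G)"
  by (rule equivI)
    (auto simp: same_component_def refl_on_def sym_def
      intro!: transI dest: symD[OF sym_rtrancl[OF sym_adjacency]] intro: rtrancl_trans)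

text \<open>If all edges of \<open>F\<close> at \<open>c\<close> were loops, a walk starting at
  \<open>c\<close> could never leave it.\<close>

lemma reach_leaves_vertex:
  assumes "(c, v) \<in> reach G F" "v \<noteq> c"
  shows "\<exists>d\<in>F. \<exists>w. w \<noteq> c \<and> ends G d = Upair c w"
proof (rule ccontr)
  assume none: "\<not> ?thesis"
  have "v = c" using assms(1) unfolding reach_def
    by (induction rule: rtrancl_induct) (use none in \<open>auto simp: adjacency_spanning_subgraph\<close>)
  then show False using assms by simp
qed

text \<open>Replacing \<open>c\<close> by \<open>a\<close> contracts the edge \<open>e\<close>. In
  particular, reachability among vertices other than \<open>c\<close> is that of \<open>H\<close>,
  whichever pendant edge is attached at \<open>c\<close>; the interchange of \<open>e\<close> and
  \<open>f\<close> rests on this.\<close>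

lemma reach_insert_pendant:
  assumes e: "ends G e = Upair c a" "a \<noteq> c"
    and H: "\<And>h. h \<in> H \<Longrightarrow> c \<notin> set_uprod (ends G h)"
  shows "(u, v) \<in> reach G (insert e H) \<longleftrightarrow>
    (if u = c then a else u, if v = c then a else v) \<in> reach G H" (is "_ \<longleftrightarrow> (?r u, ?r v) \<in> _")
proof
  assume "(u, v) \<in> reach G (insert e H)"
  then show "(?r u, ?r v) \<in> reach G H" unfolding reach_def[of G "insert e H"]
  proof (induction rule: rtrancl_induct)
    case base
    show ?case by (rule reach_refl)
  next
    case (step y z)
    from step.hyps(2) obtain d where d: "d \<in> insert e H" "ends G d = Upair y z"
      by (auto simp: adjacency_spanning_subgraph)
    have "(?r y, ?r z) \<in> reach G H"
    proof (cases "d \<in> H")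
      case True
      then have "y \<noteq> c" "z \<noteq> c" using H d by fastforce+
      then show ?thesis using reach_edge[OF True d(2)] by simp
    next
      case False
      then have "y = c \<and> z = a \<or> y = a \<and> z = c" using d e by auto
      then have "?r y = a" "?r z = a" using e by auto
      then show ?thesis by (metis reach_refl)
    qed
    then show ?case using step.IH reach_trans by metis
  qed
next
  assume "(?r u, ?r v) \<in> reach G H"
  then have "(?r u, ?r v) \<in> reach G (insert e H)"
    using reach_mono[of H "insert e H" G] by blast
  moreover have "(w, ?r w) \<in> reach G (insert e H)" for w
    using reach_edge[of e "insert e H" G c a] e by (simp add: reach_refl)
  ultimately show "(u, v) \<in> reach G (insert e H)"
    by (meson reach_sym reach_trans)
qed

text \<open>A cycle through \<open>c\<close> needs two distinct edges at \<open>c\<close> or a loop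
  there, but \<open>e\<close> is the only edge at \<open>c\<close> and is not a loop.\<close>

lemma forest_insert_pendant:
  assumes e: "ends G e = Upair c a" "a \<noteq> c"
    and H: "\<And>h. h \<in> H \<Longrightarrow> c \<notin> set_uprod (ends G h)"
  shows "forest_graph (spanning_subgraph G (insert e H)) \<longleftrightarrow> forest_graph (spanning_subgraph G H)"
proof -
  have cycle: "is_cycle (spanning_subgraph G H) vs es"
    if cyc: "is_cycle (spanning_subgraph G (insert e H)) vs es" for vs es
  proof -
    let ?n = "length es"
    have es: "es \<noteq> []" "length vs = ?n" "distinct es" "set es \<subseteq> insert e H"
      and ends: "\<And>k. k < ?n \<Longrightarrow> ends G (es ! k) = Upair (vs ! k) (vs ! (Suc k mod ?n))"
      using cyc by (auto simp: is_cycle_def spanning_subgraph_def)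
    have n: "0 < ?n" using es by simp
    have c_edge: "es ! k = e" if "k < ?n" "c \<in> set_uprod (ends G (es ! k))" for k
      using that es(4) H nth_mem by blast
    have "c \<notin> set vs"
    proof
      assume "c \<in> set vs"
      then obtain k where k: "k < ?n" "vs ! k = c" using es by (metis in_set_conv_nth)
      \<comment> \<open>The cyclic predecessor of \<open>k\<close>: the edges at positions
        \<open>l\<close> and \<open>k\<close> are those that the cycle uses at \<open>c\<close>.
        They agree in position only on a cycle of length one, that is, a loop.\<close>
      define l where "l = (if k = 0 then ?n - 1 else k - 1)"
      have l: "l < ?n" "Suc l mod ?n = k" using k n by (auto simp: l_def)
      have "es ! k = e" "es ! l = e"
        using c_edge[OF k(1)] c_edge[OF l(1)] ends[OF k(1)] ends[OF l(1)] k l by auto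
      then have "k = l" using es(3) k l nth_eq_iff_index_eq by metis
      then have "ends G e = Upair c c" using ends[OF k(1)] k l \<open>es ! k = e\<close> by simp
      then show False using e by auto
    qed
    then have "e \<notin> set es"
    proof (intro notI)
      assume "e \<in> set es" "c \<notin> set vs"
      then obtain k where k: "k < ?n" "es ! k = e" by (metis in_set_conv_nth)
      have "vs ! k \<in> set vs" "vs ! (Suc k mod ?n) \<in> set vs" using k es(2) n by auto
      then show False using ends[OF k(1)] k e \<open>c \<notin> set vs\<close> by auto
    qed
    then show ?thesis using cyc es by (auto simp: is_cycle_def spanning_subgraph_def)
  qed
  have "is_cycle (spanning_subgraph G (insert e H)) vs es"
    if "is_cycle (spanning_subgraph G H) vs es" for vs es
    using that by (auto simp: is_cycle_def spanning_subgraph_def)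
  with cycle show ?thesis by (auto simp: forest_graph_def)
qed

section \<open>Connectedness and the number of components in terms of reachability\<close>

text \<open>Choosing representatives turns a count of classes into a condition on the relation
  itself, where the description of \<open>reach\<close> can be substituted.\<close>

lemma card_quotient_eq_2_iff:
  assumes "equiv A r"
  shows "card (A // r) = 2 \<longleftrightarrow>
    (\<exists>x\<in>A. \<exists>y\<in>A. (x, y) \<notin> r \<and> (\<forall>z\<in>A. (x, z) \<in> r \<or> (y, z) \<in> r))"
proof
  assume "card (A // r) = 2"
  then obtain X Y where XY: "A // r = {X, Y}" "X \<noteq> Y" by (meson card_2_iff)
  then have "X \<in> A // r" "Y \<in> A // r" by auto
  then obtain x y where x: "x \<in> A" "X = r `` {x}" and y: "y \<in> A" "Y = r `` {y}"
    by (meson quotientE)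
  have "(x, y) \<notin> r" using XY x y assms by (metis equiv_class_eq)
  moreover have "(x, z) \<in> r \<or> (y, z) \<in> r" if "z \<in> A" for z
  proof -
    have "r `` {z} \<in> {X, Y}" using quotientI[OF that, of r] XY by simp
    then show ?thesis using that x y assms by (metis Image_singleton_iff empty_iff equiv_class_self insertE)
  qed
  ultimately show "\<exists>x\<in>A. \<exists>y\<in>A. (x, y) \<notin> r \<and> (\<forall>z\<in>A. (x, z) \<in> r \<or> (y, z) \<in> r)"
    using x y by blast
next
  assume "\<exists>x\<in>A. \<exists>y\<in>A. (x, y) \<notin> r \<and> (\<forall>z\<in>A. (x, z) \<in> r \<or> (y, z) \<in> r)"
  then obtain x y where xy: "x \<in> A" "y \<in> A" "(x, y) \<notin> r"
    and cover: "\<And>z. z \<in> A \<Longrightarrow> (x, z) \<in> r \<or> (y, z) \<in> r" by blast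
  have "A // r = {r `` {x}, r `` {y}}"
  proof (intro equalityI subsetI)
    fix X assume "X \<in> A // r"
    then obtain z where "z \<in> A" "X = r `` {z}" by (meson quotientE)
    then show "X \<in> {r `` {x}, r `` {y}}"
      using cover assms by (metis equiv_class_eq insertCI)
  qed (use xy in \<open>auto intro: quotientI\<close>)
  moreover have "r `` {x} \<noteq> r `` {y}" using xy assms by (metis eq_equiv_class)
  ultimately show "card (A // r) = 2" by simp
qed

lemma card_components_eq_2_iff:
  "card (components (spanning_subgraph G F)) = 2 \<longleftrightarrow>
    (\<exists>x\<in>verts G. \<exists>y\<in>verts G. (x, y) \<notin> reach G F \<and>
      (\<forall>z\<in>verts G. (x, z) \<in> reach G F \<or> (y, z) \<in> reach G F))"
  using card_quotient_eq_2_iff[OF equiv_same_component, of "spanning_subgraph G F"]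
  by (auto simp: components_def same_component_spanning_subgraph)

lemma connected_spanning_subgraph_iff:
  "connected_graph (spanning_subgraph G F) \<longleftrightarrow>
    verts G \<noteq> {} \<and> (\<forall>u\<in>verts G. \<forall>v\<in>verts G. (u, v) \<in> reach G F)"
  by (auto simp: connected_graph_def same_component_spanning_subgraph)


text \<open>The right-hand side mentions neither \<open>e\<close> nor \<open>a\<close>, so it serves
  equally for any other pendant edge at \<open>c\<close>.\<close>

lemma connected_insert_pendant:
  assumes e: "ends G e = Upair c a" "a \<noteq> c" and a: "a \<in> verts G"
    and H: "\<And>h. h \<in> H \<Longrightarrow> c \<notin> set_uprod (ends G h)"
  shows "connected_graph (spanning_subgraph G (insert e H)) \<longleftrightarrow>
    (\<forall>u\<in>verts G - {c}. \<forall>v\<in>verts G - {c}. (u, v) \<in> reach G H)" (is "?L \<longleftrightarrow> ?R")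
proof
  assume L: ?L
  have "(u, v) \<in> reach G H" if "u \<in> verts G - {c}" "v \<in> verts G - {c}" for u v
  proof -
    have "(u, v) \<in> reach G (insert e H)"
      using L that by (simp add: connected_spanning_subgraph_iff)
    then show ?thesis using that by (simp add: reach_insert_pendant[OF e H])
  qed
  then show ?R by blast
next
  assume R: ?R
  have "(u, v) \<in> reach G (insert e H)" if "u \<in> verts G" "v \<in> verts G" for u v
    using R that a e by (simp add: reach_insert_pendant[OF e H])
  then show ?L using a by (auto simp: connected_spanning_subgraph_iff)
qed

text \<open>Since \<open>c\<close> shares its component with \<open>a\<close>, representatives can
  be chosen away from \<open>c\<close>. Again the right-hand side is independent of the pendant
  edge.\<close>

lemma two_components_insert_pendant:
  assumes e: "ends G e = Upair c a" "a \<noteq> c" and a: "a \<in> verts G"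
    and H: "\<And>h. h \<in> H \<Longrightarrow> c \<notin> set_uprod (ends G h)"
  shows "card (components (spanning_subgraph G (insert e H))) = 2 \<longleftrightarrow>
    (\<exists>x\<in>verts G - {c}. \<exists>y\<in>verts G - {c}. (x, y) \<notin> reach G H \<and>
      (\<forall>z\<in>verts G - {c}. (x, z) \<in> reach G H \<or> (y, z) \<in> reach G H))" (is "?L \<longleftrightarrow> ?R")
proof
  let ?r = "\<lambda>w. if w = c then a else w"
  have r: "?r w \<in> verts G - {c}" if "w \<in> verts G" for w using that a e by simp
  assume ?L
  then obtain x y where xy: "x \<in> verts G" "y \<in> verts G" "(x, y) \<notin> reach G (insert e H)"
    and cover: "\<And>z. z \<in> verts G \<Longrightarrow> (x, z) \<in> reach G (insert e H) \<or> (y, z) \<in> reach G (insert e H)"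
    unfolding card_components_eq_2_iff by blast
  have "(?r x, ?r y) \<notin> reach G H"
    using xy(3) reach_insert_pendant[where u = x and v = y, OF e H] by blast
  moreover have "(?r x, z) \<in> reach G H \<or> (?r y, z) \<in> reach G H" if "z \<in> verts G - {c}" for z
    using cover[of z] that reach_insert_pendant[where u = x and v = z, OF e H]
      reach_insert_pendant[where u = y and v = z, OF e H]
    by simp
  ultimately show ?R using r[OF xy(1)] r[OF xy(2)] by blast
next
  assume ?R
  then obtain x y where xy: "x \<in> verts G - {c}" "y \<in> verts G - {c}" "(x, y) \<notin> reach G H"
    and cover: "\<And>z. z \<in> verts G - {c} \<Longrightarrow> (x, z) \<in> reach G H \<or> (y, z) \<in> reach G H"
    by blast
  \<comment> \<open>Covering \<open>c\<close> amounts to covering its neighbour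
    \<open>a\<close>.\<close>
  have "(x, if z = c then a else z) \<in> reach G H \<or> (y, if z = c then a else z) \<in> reach G H"
    if "z \<in> verts G" for z
    using cover[of "if z = c then a else z"] that a e by simp
  then show ?L
    unfolding card_components_eq_2_iff
    using xy by (intro bexI[of _ x] bexI[of _ y]) (auto simp: reach_insert_pendant[OF e H])
qed

section \<open>Components and compatibility with a bipartition\<close>

lemma mem_component_iff:
  assumes "S \<in> components (spanning_subgraph G F)" "u \<in> S"
  shows "v \<in> S \<longleftrightarrow> v \<in> verts G \<and> (u, v) \<in> reach G F"
proof -
  from assms(1) obtain w where "w \<in> verts G" "S = (reach G F \<inter> verts G \<times> verts G) `` {w}"
    by (auto simp: components_def same_component_spanning_subgraph elim: quotientE)
  then show ?thesis using assms(2) by (auto intro: reach_sym reach_trans)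
qed

lemma component_of_vertex:
  assumes "u \<in> verts G"
  shows "{v \<in> verts G. (u, v) \<in> reach G F} \<in> components (spanning_subgraph G F)"
proof -
  have "{v \<in> verts G. (u, v) \<in> reach G F} = same_component (spanning_subgraph G F) `` {u}"
    using assms by (auto simp: same_component_spanning_subgraph)
  then show ?thesis using assms by (simp add: components_def quotientI)
qed

text \<open>Trades the choice of two components for a condition on pairs of vertices in
  \<open>A \<union> B\<close>. For the converse, the nonempty parts provide vertices whose
  components are the required trees.\<close>

lemma compatible_pair_iff:
  assumes F: "spanning_2forest G F" and AB: "A \<union> B \<subseteq> verts G" "A \<inter> B = {}" "A \<noteq> {}" "B \<noteq> {}"
  shows "compatible G F {A, B} \<longleftrightarrow>
    (\<forall>u\<in>A \<union> B. \<forall>v\<in>A \<union> B. (u, v) \<in> reach G F \<longleftrightarrow> (u \<in> A \<longleftrightarrow> v \<in> A))" (is "?L \<longleftrightarrow> ?R")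
proof
  assume ?L
  then obtain A' B' S T where P: "{A, B} = {A', B'}"
    and ST: "components (spanning_subgraph G F) = {S, T}" "S \<noteq> T"
      "A' \<subseteq> S" "B' \<inter> S = {}" "B' \<subseteq> T" "A' \<inter> T = {}"
    unfolding compatible_def by (elim exE conjE) (rule that)
  have S: "S \<in> components (spanning_subgraph G F)" and T: "T \<in> components (spanning_subgraph G F)"
    using ST by auto
  \<comment> \<open>The bipartition is an unordered set, so its parts may come in either
    order.\<close>
  have cases: "A = A' \<and> B = B' \<or> A = B' \<and> B = A'"
    using P by (metis doubleton_eq_iff)
  show ?R
  proof (intro ballI)
    fix u v assume uv: "u \<in> A \<union> B" "v \<in> A \<union> B"
    then have v: "v \<in> verts G" using AB by blast
    have "u \<in> S \<or> u \<in> T" using cases ST uv by blast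
    then have "(u, v) \<in> reach G F \<longleftrightarrow> (u \<in> S \<and> v \<in> S \<or> u \<in> T \<and> v \<in> T)"
      using mem_component_iff[OF S, of u v] mem_component_iff[OF T, of u v] v by blast
    then show "(u, v) \<in> reach G F \<longleftrightarrow> (u \<in> A \<longleftrightarrow> v \<in> A)"
      using cases ST uv AB(2) by blast
  qed
next
  assume R: ?R
  obtain u v where u: "u \<in> A" and v: "v \<in> B" using AB by blast
  define S where "S = {w \<in> verts G. (u, w) \<in> reach G F}"
  define T where "T = {w \<in> verts G. (v, w) \<in> reach G F}"
  have S: "S \<in> components (spanning_subgraph G F)" and T: "T \<in> components (spanning_subgraph G F)"
    using component_of_vertex[of u G F] component_of_vertex[of v G F] u v AB by (auto simp: S_def T_def)
  have sub: "A \<subseteq> S" "B \<inter> S = {}" "B \<subseteq> T" "A \<inter> T = {}"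
    using R u v AB by (auto simp: S_def T_def)
  then have "S \<noteq> T" using u by blast
  moreover have "card (components (spanning_subgraph G F)) = 2"
    using F by (simp add: spanning_2forest_def)
  ultimately have "components (spanning_subgraph G F) = {S, T}"
    using S T by (metis card_2_iff doubleton_eq_iff insertE singletonD)
  then show ?L unfolding compatible_def using sub \<open>S \<noteq> T\<close> by blast
qed

text \<open>Let \<open>insert c A\<close> be the part containing \<open>c\<close>. Every part meets
  \<open>V - {c}\<close>, so \<open>A\<close> is nonempty and moving \<open>c\<close> leaves two
  nonempty parts.\<close>

lemma bipartition_at_vertex:
  assumes "bipartition V P" "c \<in> V" "\<And>A. A \<in> P \<Longrightarrow> A \<inter> (V - {c}) \<noteq> {}"
  obtains A B where "P = {insert c A, B}" "move c P = {A, insert c B}" "V = insert c (A \<union> B)"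
    "c \<notin> A" "c \<notin> B" "A \<inter> B = {}" "A \<noteq> {}" "B \<noteq> {}"
proof -
  obtain X Y where XY: "P = {X, Y}" "X \<noteq> Y"
    using assms(1) by (auto simp: bipartition_def card_2_iff)
  have part: "X \<union> Y = V" "X \<inter> Y = {}"
    using assms(1) XY by (auto simp: bipartition_def partition_on_def disjoint_def)
  note witness = that
  have result: thesis
    if "P = {X, Y}" "X \<union> Y = V" "X \<inter> Y = {}" "c \<in> X" for X Y
  proof (rule witness)
    show "P = {insert c (X - {c}), Y}" using that by auto
    show "move c P = {X - {c}, insert c Y}" using that by (auto simp: move_def)
    show "X - {c} \<noteq> {}" "Y \<noteq> {}" using assms(3)[of X] assms(3)[of Y] that by auto
  qed (use that in auto)
  show thesis
    using result[of X Y] result[of Y X] XY part assms(2) by blast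
qed

text \<open>Each vertex, \<open>c\<close> included, lies in one of the two trees. Once
  \<open>V - {c}\<close> is split as \<open>P\<close> prescribes, the tree containing
  \<open>c\<close> decides which of \<open>P\<close> and \<open>move c P\<close> is met. Hence the
  disjunction ignores how \<open>c\<close> is attached, and the alternatives exclude each other. As
  both parts contain vertices other than \<open>c\<close>, either alternative joins \<open>c\<close>
  to such a vertex.\<close>

lemma compatible_or_move_iff:
  assumes F: "spanning_2forest G F" and V: "V \<subseteq> verts G"
    and P: "bipartition V P" "c \<in> V" "\<And>A. A \<in> P \<Longrightarrow> A \<inter> (V - {c}) \<noteq> {}"
  shows "compatible G F P \<or> compatible G F (move c P) \<longleftrightarrow>
    (\<forall>u\<in>V - {c}. \<forall>v\<in>V - {c}. (u, v) \<in> reach G F \<longleftrightarrow> (\<exists>A\<in>P. u \<in> A \<and> v \<in> A))"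
    and "\<not> (compatible G F P \<and> compatible G F (move c P))"
    and "compatible G F P \<or> compatible G F (move c P) \<Longrightarrow> \<exists>v\<in>V - {c}. (c, v) \<in> reach G F"
proof -
  obtain A B where AB: "P = {insert c A, B}" "move c P = {A, insert c B}" "V = insert c (A \<union> B)"
    "c \<notin> A" "c \<notin> B" "A \<inter> B = {}" "A \<noteq> {}" "B \<noteq> {}"
    using bipartition_at_vertex[OF P] by metis
  obtain u v where uv: "u \<in> A" "v \<in> B" using AB by blast
  have comp: "compatible G F P \<longleftrightarrow>
    (\<forall>x\<in>V. \<forall>y\<in>V. (x, y) \<in> reach G F \<longleftrightarrow> (x \<in> insert c A \<longleftrightarrow> y \<in> insert c A))"
    using compatible_pair_iff[OF F, of "insert c A" B] V AB by auto
  have comp': "compatible G F (move c P) \<longleftrightarrow>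
    (\<forall>x\<in>V. \<forall>y\<in>V. (x, y) \<in> reach G F \<longleftrightarrow> (x \<in> A \<longleftrightarrow> y \<in> A))"
    using compatible_pair_iff[OF F, of A "insert c B"] V AB by auto
  have in_V: "c \<in> V" "u \<in> V" "v \<in> V" and ne: "u \<noteq> c" "v \<noteq> c" "u \<notin> B" "v \<notin> A"
    using AB uv by auto
  \<comment> \<open>Otherwise \<open>c\<close> and \<open>u\<close> would have to lie both in the
    same tree and in different trees.\<close>
  show "\<not> (compatible G F P \<and> compatible G F (move c P))"
    unfolding comp comp' using in_V ne uv AB by blast
  show "\<exists>v\<in>V - {c}. (c, v) \<in> reach G F" if "compatible G F P \<or> compatible G F (move c P)"
  proof -
    have "(c, u) \<in> reach G F \<or> (c, v) \<in> reach G F"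
      using that unfolding comp comp' using in_V ne uv AB by blast
    then show ?thesis using in_V ne by blast
  qed
  have part: "(\<exists>X\<in>P. x \<in> X \<and> y \<in> X) \<longleftrightarrow> (x \<in> A \<longleftrightarrow> y \<in> A)" if "x \<in> V - {c}" "y \<in> V - {c}" for x y
    using that AB by auto
  have VAB: "V - {c} = A \<union> B" using AB by auto
  let ?off = "\<forall>x\<in>V - {c}. \<forall>y\<in>V - {c}. (x, y) \<in> reach G F \<longleftrightarrow> (x \<in> A \<longleftrightarrow> y \<in> A)"
  have "compatible G F P \<or> compatible G F (move c P)" if off: ?off
  proof -
    have uv_apart: "(u, v) \<notin> reach G F" using off uv ne VAB by blast
    have "card (components (spanning_subgraph G F)) = 2"
      using F by (simp add: spanning_2forest_def)
    then obtain x y where cover: "\<And>z. z \<in> verts G \<Longrightarrow> (x, z) \<in> reach G F \<or> (y, z) \<in> reach G F"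
      unfolding card_components_eq_2_iff by blast
    have same: "(w, z) \<in> reach G F" if "(x, w) \<in> reach G F" "(x, z) \<in> reach G F" for x w z
      using that reach_sym reach_trans by metis
    \<comment> \<open>Pigeonhole: \<open>c\<close>, \<open>u\<close> and \<open>v\<close> lie in two
      components, and \<open>u\<close> and \<open>v\<close> are apart.\<close>
    have "(c, u) \<in> reach G F \<or> (c, v) \<in> reach G F"
      using cover[of c] cover[of u] cover[of v] in_V V uv_apart same by blast
    then show ?thesis
    proof
      assume cu: "(c, u) \<in> reach G F"
      have side: "(c, x) \<in> reach G F \<longleftrightarrow> x \<in> A" if "x \<in> V - {c}" for x
      proof -
        have "(c, x) \<in> reach G F \<longleftrightarrow> (u, x) \<in> reach G F"
          using cu reach_sym reach_trans by metis
        then show ?thesis using off that uv VAB by blast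
      qed
      have "(x, y) \<in> reach G F \<longleftrightarrow> (x \<in> insert c A \<longleftrightarrow> y \<in> insert c A)" if "x \<in> V" "y \<in> V" for x y
        using side[of x] side[of y] off that reach_refl[of c G F]
          reach_sym[of x c G F] reach_sym[of c x G F] by (cases "x = c"; cases "y = c") auto
      then have "compatible G F P"
        unfolding comp by blast
      then show ?thesis ..
    next
      assume cv: "(c, v) \<in> reach G F"
      have side: "(c, x) \<in> reach G F \<longleftrightarrow> x \<notin> A" if "x \<in> V - {c}" for x
      proof -
        have "(c, x) \<in> reach G F \<longleftrightarrow> (v, x) \<in> reach G F"
          using cv reach_sym reach_trans by metis
        then show ?thesis using off that uv ne VAB by blast
      qed
      have "(x, y) \<in> reach G F \<longleftrightarrow> (x \<in> A \<longleftrightarrow> y \<in> A)" if "x \<in> V" "y \<in> V" for x y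
        using side[of x] side[of y] off that reach_refl[of c G F] AB(4)
          reach_sym[of x c G F] reach_sym[of c x G F] by (cases "x = c"; cases "y = c") auto
      then have "compatible G F (move c P)"
        unfolding comp' by blast
      then show ?thesis ..
    qed
  qed
  moreover have ?off if "compatible G F P \<or> compatible G F (move c P)"
    using that unfolding comp comp' by auto
  moreover have "?off \<longleftrightarrow>
    (\<forall>u\<in>V - {c}. \<forall>v\<in>V - {c}. (u, v) \<in> reach G F \<longleftrightarrow> (\<exists>A\<in>P. u \<in> A \<and> v \<in> A))"
    by (intro ball_cong refl) (simp only: part)
  ultimately show "compatible G F P \<or> compatible G F (move c P) \<longleftrightarrow>
    (\<forall>u\<in>V - {c}. \<forall>v\<in>V - {c}. (u, v) \<in> reach G F \<longleftrightarrow> (\<exists>A\<in>P. u \<in> A \<and> v \<in> A))"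
    by argo
qed


section \<open>The two edges at a 2-valent vertex\<close>

text \<open>Valence 2 could also come from a single loop. A walk from \<open>c\<close> to
  \<open>w\<close> yields an edge at \<open>c\<close> that is not a loop, so loops are strictly
  fewer than incident edges; as the two numbers add up to 2, there are two edges and no
  loop.\<close>

lemma two_valent_edges:
  assumes G: "multigraph G" "connected_graph G" and c: "c \<in> verts G" "valence G c = 2"
    and w: "w \<in> verts G" "w \<noteq> c"
  obtains e f a b where "e \<in> edges G" "f \<in> edges G" "e \<noteq> f"
    "ends G e = Upair c a" "a \<noteq> c" "a \<in> verts G" "ends G f = Upair c b" "b \<noteq> c" "b \<in> verts G"
    "\<And>d. d \<in> edges G \<Longrightarrow> c \<in> set_uprod (ends G d) \<Longrightarrow> d = e \<or> d = f"
proof -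
  let ?I = "{e \<in> edges G. c \<in> set_uprod (ends G e)}" and ?L = "{e \<in> edges G. ends G e = Upair c c}"
  have fin: "finite ?I" "finite ?L" using G by (auto simp: multigraph_def)
  have sum: "card ?I + card ?L = 2" using c by (simp add: valence_def)
  have sub: "?L \<subseteq> ?I" by auto
  \<comment> \<open>Viewing \<open>G\<close> as its own spanning subgraph makes facts about
    \<open>reach\<close> available for it.\<close>
  have "spanning_subgraph G (edges G) = G" by (simp add: spanning_subgraph_def)
  then have "(c, w) \<in> reach G (edges G)"
    using G c w by (auto simp: connected_graph_def same_component_def reach_def)
  then obtain d u where d: "d \<in> edges G" "u \<noteq> c" "ends G d = Upair c u"
    using reach_leaves_vertex w by metis
  then have "d \<in> ?I" "d \<notin> ?L" by auto
  then have "?L \<subset> ?I" using sub by blast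
  then have "card ?L < card ?I" using fin psubset_card_mono by blast
  then have "card ?I = 2" "card ?L = 0" using sum by auto
  then obtain e f where ef: "?I = {e, f}" "e \<noteq> f" by (meson card_2_iff)
  have L: "?L = {}" using \<open>card ?L = 0\<close> fin by simp
  have other: "\<exists>a. ends G h = Upair c a \<and> a \<noteq> c \<and> a \<in> verts G" if "h \<in> ?I" for h
  proof -
    obtain x y where xy: "ends G h = Upair x y" by (cases "ends G h") auto
    then have "x = c \<or> y = c" using that by auto
    then obtain a where a: "ends G h = Upair c a" using xy by (metis Upair_inject)
    moreover have "a \<noteq> c" using a L that by blast
    moreover have "a \<in> verts G" using a that G by (fastforce simp: multigraph_def)
    ultimately show ?thesis by blast
  qed
  obtain a b where ab: "ends G e = Upair c a \<and> a \<noteq> c \<and> a \<in> verts G"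
    "ends G f = Upair c b \<and> b \<noteq> c \<and> b \<in> verts G"
    using other[of e] other[of f] ef by blast
  show thesis by (rule that[of e f a b]) (use ef ab in auto)
qed

section \<open>Grouping the edge partitions into orbits\<close>

theorem theorem7p6:
  fixes p :: nat and G :: "('v, 'e) mgraph" and V :: "'v set" and c :: 'v
    and P :: "nat \<Rightarrow> 'v set set" and i :: nat
  assumes "prime p"
    and "multigraph G" and "connected_graph G"
    and "V \<subseteq> verts G" and "c \<in> V" and "valence G c = 2"
    and "\<And>j. j \<in> {1..p - 1} \<Longrightarrow> bipartition V (P j)"
    and "\<And>j A. j \<in> {1..p - 1} \<Longrightarrow> A \<in> P j \<Longrightarrow> A \<inter> (V - {c}) \<noteq> {}"
    and "i \<in> {1..p - 1}"
  shows "(\<exists>\<Q>. partition_on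
              (edge_partitions G p P \<union> edge_partitions G p (P(i := move c (P i)))) \<Q> \<and>
            (\<forall>X\<in>\<Q>. finite X \<and> p dvd card X)) \<and>
         [num_edge_partitions G p P + num_edge_partitions G p (P(i := move c (P i))) = 0] (mod p)"
proof -
  let ?P' = "P(i := move c (P i))"
  let ?I = "{1..p - 1}"
  note V = \<open>V \<subseteq> verts G\<close> and c = \<open>c \<in> V\<close> and bip = assms(7) and hits = assms(8) and i = assms(9)
  note compat = compatible_or_move_iff[OF _ V bip c hits]
  \<comment> \<open>A second marked vertex serves twice: it rules out a loop at \<open>c\<close>,
    and it forces every spanning tree to use an edge at \<open>c\<close>.\<close>
  obtain w where w: "w \<in> V - {c}"
    using bipartition_at_vertex[OF bip[OF i] c hits[OF i]]
    by (metis Diff_iff Un_iff ex_in_conv insertE insertI2 singletonD)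
  then have w': "w \<in> verts G" "w \<noteq> c" and cG: "c \<in> verts G" using V c by auto
  obtain e f a b where ef: "e \<in> edges G" "f \<in> edges G" "e \<noteq> f"
    and e: "ends G e = Upair c a" "a \<noteq> c" and a: "a \<in> verts G"
    and f: "ends G f = Upair c b" "b \<noteq> c" and b: "b \<in> verts G"
    and only: "\<And>d. d \<in> edges G \<Longrightarrow> c \<in> set_uprod (ends G d) \<Longrightarrow> d = e \<or> d = f"
    using two_valent_edges[OF assms(2,3) cG assms(6) w'] by blast
  have off_c: "c \<notin> set_uprod (ends G h)" if "H \<subseteq> edges G" "e \<notin> H" "f \<notin> H" "h \<in> H" for H h
    using only that by blast
  have meets: "e \<in> F \<or> f \<in> F" if F: "F \<subseteq> edges G" and v: "(c, v) \<in> reach G F" "v \<noteq> c" for F v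
  proof -
    obtain d u where d: "d \<in> F" "ends G d = Upair c u"
      using reach_leaves_vertex[OF v] by blast
    then have "d = e \<or> d = f" using only[of d] F by auto
    then show ?thesis using d by blast
  qed

  \<comment> \<open>Position \<open>i\<close> admits both bipartitions, so that the union of the two
    sets of tuples is described by one condition per position.\<close>
  define Q where "Q j F \<longleftrightarrow> compatible G F (P j) \<or> (j = i \<and> compatible G F (move c (P i)))" for j F
  define A where "A x = (case x of Inl j \<Rightarrow> {F. spanning_tree G F}
    | Inr j \<Rightarrow> {F. spanning_2forest G F \<and> Q j F})" for x :: "nat + nat"
  define J where "J = ?I <+> ?I"
  \<comment> \<open>The \<open>p - 1\<close> tree positions and the \<open>i\<close>-th forest
    position make up the \<open>p\<close> interchangeable ones.\<close>
  define J0 where "J0 = insert (Inr i) (Inl ` ?I)"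
  define U where "U = {F \<in> Pi\<^sub>E J A. \<forall>d\<in>edges G. card {x \<in> J. d \<in> F x} = p - 1}"
  \<comment> \<open>Joins the two tuples into one family on the sum type. Default values outside the
    index sets correspond, so extensionality carries over.\<close>
  define h where "h z = (case z of (\<psi>, \<phi>) \<Rightarrow> case_sum \<psi> \<phi>)" for z :: "(nat \<Rightarrow> 'e set) \<times> (nat \<Rightarrow> 'e set)"
  define W where "W = edge_partitions G p P \<union> edge_partitions G p ?P'"

  have fibre: "p dvd card {F' \<in> U. \<forall>x\<in>J. F' x - {e, f} = F x - {e, f}}" if "F \<in> U" for F
  proof (rule prime_dvd_card_swap_fibre[OF \<open>prime p\<close> _ _ ef(3,1,2) _ _ _ _ U_def that])
    show "finite J" by (simp add: J_def)
    show "card J = 2 * (p - 1)" by (simp add: J_def card_Plus)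
    show "J0 \<subseteq> J" using i by (auto simp: J0_def J_def)
    have "card J0 = Suc (card ?I)"
      unfolding J0_def by (subst card_insert_disjoint) (auto simp: card_image)
    then show "card J0 = p"
      using prime_gt_0_nat[OF \<open>prime p\<close>] by simp
    show "e \<in> Y \<or> f \<in> Y" if x: "x \<in> J" and Y: "Y \<in> A x" for x Y
    proof (cases x)
      case (Inl j)
      then have "Y \<subseteq> edges G" "(c, w) \<in> reach G Y"
        using Y cG w' by (auto simp: A_def spanning_tree_def tree_graph_def connected_spanning_subgraph_iff)
      then show ?thesis using meets w' by blast
    next
      case (Inr j)
      then have j: "j \<in> ?I" and Y': "spanning_2forest G Y" "Q j Y"
        using x Y by (auto simp: A_def J_def)
      then obtain v where "v \<in> V - {c}" "(c, v) \<in> reach G Y"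
        using compat(3)[OF Y'(1) j j] by (auto simp: Q_def)
      then show ?thesis using meets[of Y v] Y' by (auto simp: spanning_2forest_def)
    qed
    show "insert e H \<in> A x \<longleftrightarrow> insert f H \<in> A x" if x: "x \<in> J0" and H: "e \<notin> H" "f \<notin> H" for x H
    proof (cases "H \<subseteq> edges G")
      case False
      then show ?thesis
        by (auto simp: A_def spanning_tree_def spanning_2forest_def split: sum.split)
    next
      case True
      note Hc = off_c[OF True H]
      have tree: "spanning_tree G (insert e H) \<longleftrightarrow> spanning_tree G (insert f H)"
        using ef True
        by (simp add: spanning_tree_def tree_graph_def forest_insert_pendant[OF e Hc]
            forest_insert_pendant[OF f Hc] connected_insert_pendant[OF e a Hc]
            connected_insert_pendant[OF f b Hc])
      have forest: "spanning_2forest G (insert e H) \<longleftrightarrow> spanning_2forest G (insert f H)"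
        using ef True
        by (simp add: spanning_2forest_def forest_insert_pendant[OF e Hc]
            forest_insert_pendant[OF f Hc] two_components_insert_pendant[OF e a Hc]
            two_components_insert_pendant[OF f b Hc])
      \<comment> \<open>By the first part of \<open>compat\<close>, \<open>Q i\<close> concerns only
        reachability within \<open>V - {c}\<close>, which a pendant edge at \<open>c\<close> leaves
        unchanged.\<close>
      have "Q i (insert e H) \<longleftrightarrow> Q i (insert f H)"
        if "spanning_2forest G (insert e H)" "spanning_2forest G (insert f H)"
        using compat(1)[OF that(1) i i] compat(1)[OF that(2) i i]
        by (simp add: Q_def reach_insert_pendant[OF e Hc] reach_insert_pendant[OF f Hc])
      then show ?thesis
        using x tree forest by (auto simp: A_def J0_def)
    qed
  qed

  have W_iff: "z \<in> W \<longleftrightarrow> h z \<in> U" for z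
  proof -
    obtain \<psi> \<phi> where z: "z = (\<psi>, \<phi>)" by (cases z)
    have "{x \<in> J. d \<in> h z x} = {j \<in> ?I. d \<in> \<psi> j} <+> {j \<in> ?I. d \<in> \<phi> j}" for d
      by (auto simp: J_def h_def z)
    then have "card {x \<in> J. d \<in> h z x} = card {j \<in> ?I. d \<in> \<psi> j} + card {j \<in> ?I. d \<in> \<phi> j}" for d
      by (simp add: card_Plus)
    moreover have "h z \<in> Pi\<^sub>E J A \<longleftrightarrow> \<psi> \<in> (\<Pi>\<^sub>E j\<in>?I. {F. spanning_tree G F}) \<and>
        \<phi> \<in> (\<Pi>\<^sub>E j\<in>?I. {F. spanning_2forest G F \<and> Q j F})"
      by (auto simp: PiE_iff extensional_def J_def h_def z A_def split_sum_all Ball_def)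
    \<comment> \<open>The disjunction in \<open>Q\<close> can be pulled out of the product because
      it is proper at the single index \<open>i\<close>.\<close>
    moreover have "\<phi> \<in> (\<Pi>\<^sub>E j\<in>?I. {F. spanning_2forest G F \<and> Q j F}) \<longleftrightarrow>
        \<phi> \<in> (\<Pi>\<^sub>E j\<in>?I. {F. spanning_2forest G F \<and> compatible G F (P j)}) \<or>
        \<phi> \<in> (\<Pi>\<^sub>E j\<in>?I. {F. spanning_2forest G F \<and> compatible G F (?P' j)})"
      using i by (auto simp: PiE_iff Q_def)
    ultimately show ?thesis
      by (auto simp: W_def edge_partitions_def U_def z)
  qed
  have h_inj: "inj h"
    by (auto simp: inj_def h_def fun_eq_iff split: sum.splits)
  have h_surj: "\<exists>z. F = h z" for F
    by (rule exI[of _ "(F \<circ> Inl, F \<circ> Inr)"]) (auto simp: h_def fun_eq_iff split: sum.split)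

  have "finite (Pi\<^sub>E J A)"
  proof (rule finite_PiE)
    have "A x \<subseteq> Pow (edges G)" for x
      by (auto simp: A_def spanning_tree_def spanning_2forest_def split: sum.splits)
    then show "finite (A x)" for x
      using \<open>multigraph G\<close> finite_subset[of "A x" "Pow (edges G)"] by (auto simp: multigraph_def)
  qed (simp add: J_def)
  then have "finite U" by (simp add: U_def)
  moreover have "h ` W \<subseteq> U" using W_iff by blast
  ultimately have finW: "finite W"
    using h_inj by (meson finite_imageD finite_subset inj_on_subset subset_UNIV)

  \<comment> \<open>The orbit of \<open>z\<close>: all tuples of the union that agree with it up to
    \<open>e\<close> and \<open>f\<close>.\<close>
  define cls where "cls z = {z' \<in> W. \<forall>x\<in>J. h z' x - {e, f} = h z x - {e, f}}" for z
  have dvd: "p dvd card (cls z)" if "z \<in> W" for z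
  proof -
    \<comment> \<open>Surjectivity of \<open>h\<close> ensures that the whole fibre in
      \<open>U\<close> is reached, so orbit and fibre have the same size.\<close>
    have "h ` cls z = {F' \<in> U. \<forall>x\<in>J. F' x - {e, f} = h z x - {e, f}}"
      using h_surj by (auto simp: cls_def W_iff image_iff) metis
    moreover have "card (h ` cls z) = card (cls z)"
      using h_inj by (meson card_image inj_on_subset subset_UNIV)
    ultimately show ?thesis using fibre[of "h z"] that W_iff by simp
  qed
  have part: "partition_on W (cls ` W)"
  proof (rule partition_onI)
    show "\<Union> (cls ` W) = W" by (auto simp: cls_def)
    show "disjnt X Y" if "X \<in> cls ` W" "Y \<in> cls ` W" "X \<noteq> Y" for X Y
    proof -
      have "cls z = cls y" if "z \<in> cls y" for y z
        using that by (simp add: cls_def)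
      with that show ?thesis
        unfolding disjnt_iff by (metis imageE)
    qed
    show "{} \<notin> cls ` W" by (auto simp: cls_def)
  qed
  have fin_cls: "finite X \<and> p dvd card X" if "X \<in> cls ` W" for X
    using that dvd finW by (auto simp: cls_def)

  have "card W = (\<Sum>X\<in>cls ` W. card X)"
    using part fin_cls card_Union_disjoint[of "cls ` W"]
    by (auto simp: partition_on_def disjoint_def pairwise_def disjnt_def)
  then have "p dvd card W" using fin_cls by (auto intro: dvd_sum)
  \<comment> \<open>The \<open>i\<close>-th forest cannot be compatible with both bipartitions, so
    the cardinality of the union is the sum in the congruence.\<close>
  moreover have "edge_partitions G p P \<inter> edge_partitions G p ?P' = {}"
  proof -
    have "spanning_2forest G (snd z i) \<and> compatible G (snd z i) (R i)"
      if "z \<in> edge_partitions G p R" for z R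
      using that i by (auto simp: edge_partitions_def dest: PiE_mem)
    from this[of _ P] this[of _ ?P'] show ?thesis
      using compat(2)[OF _ i i] by fastforce
  qed
  ultimately have "p dvd num_edge_partitions G p P + num_edge_partitions G p ?P'"
    using finW by (simp add: W_def num_edge_partitions_def card_Un_disjoint)
  then show ?thesis
    using part fin_cls unfolding W_def by (auto simp: cong_0_iff)
qed

end
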